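(* Let $|||\cdot|||$ be a weakly unitarily invariant norm on $(M_{n}(\mathbb{C}),tr)$. Then for every $T\in M_n(\mathbb{C})$, $$|||T|||=\sup_{X\in M_n(\mathbb{C}),\ |||X|||^{\sharp}\leq 1}\omega_{X}(T).$$
   Context: $tr$ is the normalized trace on the algebra $M_{n}(\mathbb{C})$ of $n\times n$ complex matrices, and $\mathscr{U}(M_{n}(\mathbb{C}))$ is the set of unitary matrices. A norm $|||\cdot|||$ on $M_n(\mathbb{C})$ is weakly unitarily invariant if $|||UTU^{*}|||=|||T|||$ for all $T\in M_n(\mathbb{C})$ and $U\in\mathscr{U}(M_n(\mathbb{C}))$. The dual norm of $|||\cdot|||$ with respect to $tr$ is $$|||T|||^{\sharp}=\sup\{|tr(TX)|:X\in M_n(\mathbb{C}),\ |||X|||\leq 1\}.$$ For $X,T\in M_n(\mathbb{C})$, the $X$-numerical radius of $T$ is $$\omega_{X}(T)=\max_{U\in\mathscr{U}(M_n(\mathbb{C}))}|tr(XUTU^{*})|.$$ *)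

theory Defs
  imports "HOL-Analysis.Analysis"
begin

definition normalized_trace :: "complex^'n^'n \<Rightarrow> complex"
  where "normalized_trace A = trace A / of_nat CARD('n)"

definition conj_transpose :: "complex^'n^'n \<Rightarrow> complex^'n^'n"
  where "conj_transpose A = transpose (map_matrix cnj A)"

definition unitary_matrices :: "(complex^'n^'n) set"
  where "unitary_matrices =
    {U. U ** conj_transpose U = mat 1 \<and> conj_transpose U ** U = mat 1}"

text \<open>A norm on the complex vector space of matrices; homogeneity is over the complex scalars.\<close>

definition matrix_norm :: "(complex^'n^'n \<Rightarrow> real) \<Rightarrow> bool"
  where "matrix_norm N \<longleftrightarrow>
    (\<forall>A. 0 \<le> N A) \<and>
    (\<forall>A. N A = 0 \<longleftrightarrow> A = 0) \<and>
    (\<forall>c A. N (map_matrix (\<lambda>a. c * a) A) = cmod c * N A) \<and>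
    (\<forall>A B. N (A + B) \<le> N A + N B)"

definition weakly_unitarily_invariant :: "(complex^'n^'n \<Rightarrow> real) \<Rightarrow> bool"
  where "weakly_unitarily_invariant N \<longleftrightarrow>
    (\<forall>T. \<forall>U\<in>unitary_matrices. N (U ** T ** conj_transpose U) = N T)"

text \<open>The supremum is that of a nonempty set of reals, which is bounded above when \<open>N\<close> is a norm
  because all norms on a finite-dimensional space are equivalent.\<close>

definition dual_norm :: "(complex^'n^'n \<Rightarrow> real) \<Rightarrow> complex^'n^'n \<Rightarrow> real"
  where "dual_norm N T = (SUP X\<in>{X. N X \<le> 1}. cmod (normalized_trace (T ** X)))"

text \<open>The greatest element exists by compactness of the unitary group.
  (\<open>Max\<close> is not usable here, as it is meant for finite sets only.)\<close>

definition numerical_radius :: "complex^'n^'n \<Rightarrow> complex^'n^'n \<Rightarrow> real"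
  where "numerical_radius X T =
    (GREATEST r. \<exists>U\<in>unitary_matrices.
       r = cmod (normalized_trace (X ** U ** T ** conj_transpose U)))"

end

theory Submission
  imports Defs
begin

text \<open>
  Weak unitary invariance makes the numerical radius interact with the norm exactly as the trace
  pairing does. Each value \<open>|tr (X U T U\<^sup>*)|\<close> is at most the dual norm of \<open>X\<close> times
  \<open>N (U T U\<^sup>*) = N T\<close>, so no \<open>X\<close> in the dual unit ball has \<open>X\<close>-numerical radius of \<open>T\<close> above
  \<open>N T\<close>. Conversely, taking \<open>U = 1\<close> shows that the radius is at least \<open>|tr (X T)|\<close>, and what remains
  is that a norm on a finite-dimensional space is its own bidual: some \<open>X\<close> in the dual unit ball has
  \<open>|tr (X T)| \<ge> N T\<close>. This is the lemma \<open>dual_norm_attained\<close>. Its \<open>X\<close> comes from a hyperplane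
  separating \<open>T\<close> from the open \<open>N\<close>-ball of radius \<open>N T\<close>, because every real-linear functional
  on matrices is the real part of a trace pairing.

  Two compactness arguments give the extremal values their meaning. Compactness of the unit ball of
  \<open>N\<close> makes the supremum that defines the dual norm finite, which is used in
  \<open>cmod_normalized_trace_le\<close>; compactness of the unitary group makes the numerical radius a maximum.
\<close>

section \<open>The trace pairing\<close>

lemma conj_transpose_nth [simp]: "conj_transpose A $ i $ j = cnj (A $ j $ i)"
  by (simp add: conj_transpose_def transpose_def map_matrix_def)

lemma trace_mult_eq_sum:
  fixes A :: "complex^'m^'n" and B :: "complex^'n^'m"
  shows "trace (A ** B) = (\<Sum>i\<in>UNIV. \<Sum>j\<in>UNIV. A $ i $ j * B $ j $ i)"
  by (simp add: trace_def matrix_matrix_mult_def)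

text \<open>
  This turns the normal vector of a separating hyperplane into a matrix acting through the trace. For
  \<open>A = B\<close> it also gives the Euclidean norm of a unitary matrix.
\<close>

lemma inner_eq_Re_trace:
  fixes A B :: "complex^'n^'n"
  shows "A \<bullet> B = Re (trace (conj_transpose A ** B))"
proof -
  have "Re (trace (conj_transpose A ** B)) = (\<Sum>i\<in>UNIV. \<Sum>j\<in>UNIV. A $ j $ i \<bullet> B $ j $ i)"
    by (simp add: trace_mult_eq_sum inner_complex_def)
  also have "\<dots> = A \<bullet> B"
    by (simp add: inner_vec_def) (rule sum.swap)
  finally show ?thesis ..
qed

lemma normalized_trace_0 [simp]: "normalized_trace 0 = 0"
  by (simp add: normalized_trace_def trace_def)

lemma normalized_trace_scale_right:
  "normalized_trace (X ** map_matrix (\<lambda>a. c * a) A) = c * normalized_trace (X ** A)"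
  by (simp add: normalized_trace_def trace_mult_eq_sum map_matrix_def sum_distrib_left mult_ac)

lemma normalized_trace_scale_left:
  "normalized_trace (map_matrix (\<lambda>a. c * a) X ** A) = c * normalized_trace (X ** A)"
  by (simp add: normalized_trace_def trace_mult_eq_sum map_matrix_def sum_distrib_left mult_ac)

lemma continuous_on_normalized_trace_mult:
  "continuous_on S (\<lambda>X. cmod (normalized_trace (A ** X)))"
  unfolding normalized_trace_def trace_mult_eq_sum by (intro continuous_intros) auto

section \<open>Norms on matrices\<close>

lemma scaleR_eq_map_matrix:
  fixes A :: "complex^'n^'n"
  shows "c *\<^sub>R A = map_matrix (\<lambda>a. of_real c * a) A"
  by (simp add: vec_eq_iff map_matrix_def scaleR_conv_of_real[where 'a = complex])

locale normed_matrices =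
  fixes N :: "complex^'n^'n \<Rightarrow> real"
  assumes matrix_norm: "matrix_norm N"
begin

lemma nonneg: "0 \<le> N A"
  and eq_0_iff: "N A = 0 \<longleftrightarrow> A = 0"
  and scale: "N (map_matrix (\<lambda>a. c * a) A) = cmod c * N A"
  and triangle: "N (A + B) \<le> N A + N B"
  using matrix_norm by (simp_all add: matrix_norm_def)

lemma scaleR: "N (c *\<^sub>R A) = \<bar>c\<bar> * N A"
  by (simp add: scaleR_eq_map_matrix scale)

text \<open>Convexity is the quickest way to continuity: convex functions on a Euclidean space are continuous.\<close>

lemma convex_on: "convex_on UNIV N"
proof (rule convex_onI)
  fix t :: real and A B
  assume "0 < t" "t < 1"
  then show "N ((1 - t) *\<^sub>R A + t *\<^sub>R B) \<le> (1 - t) * N A + t * N B"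
    using triangle[of "(1 - t) *\<^sub>R A" "t *\<^sub>R B"] by (simp add: scaleR)
qed simp

lemma continuous: "continuous_on UNIV N"
  by (rule convex_on_continuous[OF open_UNIV convex_on])

text \<open>
  The nontrivial half of the equivalence of norms: \<open>N\<close> is continuous and positive on the compact
  Euclidean unit sphere, so it has a positive minimum there, and \<open>K\<close> is the inverse of that minimum.
\<close>

lemma norm_le: obtains K where "0 < K" "\<And>A. norm A \<le> K * N A"
proof -
  have "\<exists>B \<in> sphere 0 1. \<forall>A \<in> sphere 0 1. N B \<le> N A"
    by (intro continuous_attains_inf continuous_on_subset[OF continuous]) auto
  then obtain B where B: "norm B = 1" "\<And>A. norm A = 1 \<Longrightarrow> N B \<le> N A"
    by (auto simp: dist_norm)
  have pos: "0 < N B"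
    using B(1) nonneg[of B] eq_0_iff[of B] by (auto simp: less_le)
  have "norm A \<le> inverse (N B) * N A" for A
  proof (cases "A = 0")
    case False
    then have "N B \<le> N (inverse (norm A) *\<^sub>R A)"
      by (intro B(2)) simp
    then show ?thesis
      using False pos by (simp add: scaleR field_simps)
  qed (simp add: nonneg)
  with pos show ?thesis
    by (intro that[of "inverse (N B)"]) auto
qed

lemma compact_unit_ball: "compact {A. N A \<le> 1}"
proof -
  obtain K where "0 < K" "\<And>A. norm A \<le> K * N A"
    by (rule norm_le) blast
  then have "norm A \<le> K" if "N A \<le> 1" for A
    using mult_left_mono[OF that, of K] by (smt (verit, best) mult.right_neutral)
  then have "bounded {A. N A \<le> 1}"
    by (auto simp: bounded_iff)
  moreover have "closed {A. N A \<le> 1}"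
    by (intro closed_Collect_le continuous continuous_on_const)
  ultimately show ?thesis
    by (simp add: compact_eq_bounded_closed)
qed

lemma zero_in_unit_ball: "0 \<in> {A. N A \<le> 1}"
  using eq_0_iff[of 0] by simp

text \<open>
  The Hoelder inequality for \<open>N\<close> and its dual. After normalizing \<open>A\<close> it is the upper bound property of
  the supremum, for which the values on the unit ball have to be bounded: they are a continuous
  image of a compact set.
\<close>

lemma cmod_normalized_trace_le:
  "cmod (normalized_trace (X ** A)) \<le> dual_norm N X * N A"
proof (cases "A = 0")
  case True
  then show ?thesis
    using eq_0_iff[of 0] by simp
next
  case False
  then have pos: "0 < N A"
    using nonneg[of A] eq_0_iff[of A] by simp
  have "bdd_above ((\<lambda>B. cmod (normalized_trace (X ** B))) ` {B. N B \<le> 1})"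
    by (intro bounded_imp_bdd_above compact_imp_bounded compact_continuous_image
        continuous_on_normalized_trace_mult compact_unit_ball)
  then have "cmod (normalized_trace (X ** (inverse (N A) *\<^sub>R A))) \<le> dual_norm N X"
    unfolding dual_norm_def using pos by (intro cSUP_upper) (auto simp: scaleR)
  then show ?thesis
    unfolding scaleR_eq_map_matrix normalized_trace_scale_right norm_mult
    using pos by (simp add: norm_divide field_simps)
qed

text \<open>
  The Hahn-Banach theorem in finite dimensions. A hyperplane with normal \<open>a\<close> separates \<open>T\<close> from the
  open \<open>N\<close>-ball of radius \<open>N T\<close>; a scaled adjoint of \<open>a\<close> is the required \<open>X\<close>. The hyperplane only
  controls the real part of \<open>tr (X A)\<close>. Multiplying \<open>A\<close> by a phase, which does not increase \<open>N\<close>,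
  makes the trace real and nonnegative and so extends the bound to its modulus.
\<close>

lemma dual_norm_attained:
  obtains X where "dual_norm N X \<le> 1" "N T \<le> cmod (normalized_trace (X ** T))"
proof (cases "T = 0")
  case True
  have "dual_norm N 0 \<le> 1"
    unfolding dual_norm_def using zero_in_unit_ball
    by (intro cSUP_least) auto
  then show ?thesis
    using True eq_0_iff[of 0] by (intro that[of 0]) auto
next
  case False
  then have pos: "0 < N T"
    using nonneg[of T] eq_0_iff[of T] by simp
  let ?S = "{A. N A < N T}"
  have "convex ?S"
  proof (rule convexI)
    fix A B and u v :: real
    assume "A \<in> ?S" "B \<in> ?S" "0 \<le> u" "0 \<le> v" "u + v = 1"
    then show "u *\<^sub>R A + v *\<^sub>R B \<in> ?S"
      using triangle[of "u *\<^sub>R A" "v *\<^sub>R B"]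
        convex_bound_lt[of "N A" "N T" "N B" u v] by (simp add: scaleR)
  qed
  moreover have "0 \<in> ?S"
    using pos eq_0_iff[of 0] by simp
  ultimately obtain a b where a: "a \<noteq> 0" and le_b: "\<And>A. N A < N T \<Longrightarrow> a \<bullet> A \<le> b" and b_le: "b \<le> a \<bullet> T"
    using separating_hyperplane_sets[of ?S "{T}"] by auto
  \<comment> \<open>The offset \<open>b\<close> is positive because the open ball contains a small multiple of \<open>a\<close>.\<close>
  define r where "r = N T / (2 * N a)"
  have Na: "0 < N a"
    using a nonneg[of a] eq_0_iff[of a] by simp
  have "0 < a \<bullet> (r *\<^sub>R a)"
    using a pos Na by (simp add: r_def)
  also have "\<dots> \<le> b"
    using pos Na by (intro le_b) (simp add: scaleR r_def)
  finally have b: "0 < b" .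
  \<comment> \<open>The bound passes from the open ball to the closed one by shrinking.\<close>
  have bound: "a \<bullet> A \<le> b" if "N A \<le> N T" for A
  proof (rule field_le_mult_one_interval)
    fix t :: real assume t: "0 < t" "t < 1"
    have "t * N A \<le> t * N T"
      using that t by simp
    also have "\<dots> < N T"
      using t pos by simp
    finally have "N (t *\<^sub>R A) < N T"
      using t by (simp add: scaleR)
    then show "t * (a \<bullet> A) \<le> b"
      using le_b by fastforce
  qed
  \<comment> \<open>\<open>CARD('n)\<close> undoes the normalization of the trace; \<open>N T / b\<close> makes the bound on the unit ball 1.\<close>
  define X where "X = map_matrix (\<lambda>z. of_real (of_nat CARD('n) * N T / b) * z) (conj_transpose a)"
  have Re_X: "Re (normalized_trace (X ** A)) = N T / b * (a \<bullet> A)" for A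
    unfolding X_def normalized_trace_scale_left
    by (simp add: normalized_trace_def inner_eq_Re_trace)
  show ?thesis
  proof
    have "cmod (normalized_trace (X ** A)) \<le> 1" if A: "N A \<le> 1" for A
    proof -
      define z where "z = normalized_trace (X ** A)"
      \<comment> \<open>The phase with \<open>c * z = |z|\<close>; if \<open>z = 0\<close> then \<open>c = 0\<close> and the equation still holds.\<close>
      define c where "c = cnj (sgn z)"
      define B where "B = map_matrix (\<lambda>w. c * w) A"
      have "c * z = z * cnj z / of_real (cmod z)"
        by (simp add: c_def sgn_eq)
      also have "\<dots> = of_real (cmod z)"
        by (simp add: power2_eq_square flip: complex_norm_square)
      finally have "cmod z = Re (c * z)"
        by simp
      also have "\<dots> = N T / b * (a \<bullet> B)"
        unfolding z_def normalized_trace_scale_right[symmetric] B_def[symmetric] by (rule Re_X)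
      also have "\<dots> = (a \<bullet> (N T *\<^sub>R B)) / b"
        by simp
      also have "\<dots> \<le> 1"
      proof -
        have "N B \<le> 1"
          using A nonneg[of A] by (simp add: B_def scale c_def norm_sgn)
        then have "N (N T *\<^sub>R B) \<le> N T"
          using pos by (simp add: scaleR mult_left_le)
        from bound[OF this] b show ?thesis by simp
      qed
      finally show ?thesis by (simp add: z_def)
    qed
    then show "dual_norm N X \<le> 1"
      unfolding dual_norm_def using zero_in_unit_ball by (intro cSUP_least) auto
    have "N T \<le> N T / b * (a \<bullet> T)"
      using b b_le pos by (simp add: field_simps)
    also have "\<dots> \<le> cmod (normalized_trace (X ** T))"
      unfolding Re_X[symmetric] by (rule complex_Re_le_cmod)
    finally show "N T \<le> cmod (normalized_trace (X ** T))" .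
  qed
qed

end

section \<open>The numerical radius\<close>

lemma continuous_on_matrix_mult:
  fixes f :: "'a::topological_space \<Rightarrow> complex^'n^'m" and g :: "'a \<Rightarrow> complex^'k^'n"
  assumes "continuous_on S f" "continuous_on S g"
  shows "continuous_on S (\<lambda>x. f x ** g x)"
  unfolding matrix_matrix_mult_def
  by (intro continuous_on_vec_lambda continuous_intros assms)

lemma continuous_on_conj_transpose: "continuous_on S conj_transpose"
  unfolding conj_transpose_def[abs_def] transpose_def map_matrix_def
  by (simp, intro continuous_on_vec_lambda continuous_intros)

text \<open>
  The unitary group is closed as the solution set of continuous equations. It is bounded since
  the trace of \<open>U\<^sup>* U = 1\<close> is the squared Euclidean norm of \<open>U\<close>, which puts it on a sphere.
\<close>

lemma compact_unitary_matrices: "compact (unitary_matrices :: (complex^'n^'n) set)"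
proof -
  have "norm U = sqrt CARD('n)" if "U \<in> unitary_matrices" for U :: "complex^'n^'n"
    using that by (simp add: norm_eq_sqrt_inner inner_eq_Re_trace unitary_matrices_def trace_I)
  then have "bounded (unitary_matrices :: (complex^'n^'n) set)"
    by (auto simp: bounded_iff)
  moreover have "closed (unitary_matrices :: (complex^'n^'n) set)"
    unfolding unitary_matrices_def
    by (intro closed_Collect_conj closed_Collect_eq continuous_on_matrix_mult
        continuous_on_conj_transpose continuous_on_id continuous_on_const)
  ultimately show ?thesis
    by (simp add: compact_eq_bounded_closed)
qed

lemma mat_1_unitary: "mat 1 \<in> unitary_matrices"
  and conj_transpose_mat_1: "conj_transpose (mat 1) = mat 1"
proof -
  show "conj_transpose (mat 1) = mat 1"
    by (auto simp: vec_eq_iff mat_def)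
  then show "mat 1 \<in> unitary_matrices"
    by (simp add: unitary_matrices_def)
qed

text \<open>
  A continuous function on the compact unitary group attains its maximum, so the greatest element in
  the definition exists, and it is both a value and an upper bound of the values.
\<close>

lemma numerical_radius_attained:
  obtains U where "U \<in> unitary_matrices"
    "numerical_radius X T = cmod (normalized_trace (X ** U ** T ** conj_transpose U))"
    "\<And>V. V \<in> unitary_matrices \<Longrightarrow>
      cmod (normalized_trace (X ** V ** T ** conj_transpose V)) \<le> numerical_radius X T"
proof -
  let ?f = "\<lambda>U. cmod (normalized_trace (X ** U ** T ** conj_transpose U))"
  have "continuous_on UNIV (\<lambda>A. cmod (normalized_trace A))"
    using continuous_on_normalized_trace_mult[of UNIV "mat 1"] by simp
  then have "continuous_on unitary_matrices ?f"
    by (rule continuous_on_compose2) (intro continuous_on_matrix_mult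
        continuous_on_conj_transpose continuous_on_id continuous_on_const subset_UNIV)+
  then obtain U where U: "U \<in> unitary_matrices" "\<forall>V\<in>unitary_matrices. ?f V \<le> ?f U"
    using continuous_attains_sup[OF compact_unitary_matrices, of ?f] mat_1_unitary by blast
  have "numerical_radius X T = ?f U"
    unfolding numerical_radius_def using U by (intro Greatest_equality) auto
  with U show ?thesis
    by (intro that[of U]) auto
qed

theorem proposition2p6:
  fixes N :: "complex^'n^'n \<Rightarrow> real"
    and T :: "complex^'n^'n"
  assumes "matrix_norm N"
    and "weakly_unitarily_invariant N"
  shows "N T = (SUP X\<in>{X. dual_norm N X \<le> 1}. numerical_radius X T)"
proof -
  interpret normed_matrices N
    by standard (rule assms)
  have le: "numerical_radius X T \<le> N T" if X: "dual_norm N X \<le> 1" for X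
  proof -
    obtain U where U: "U \<in> unitary_matrices"
      "numerical_radius X T = cmod (normalized_trace (X ** U ** T ** conj_transpose U))"
      by (rule numerical_radius_attained)
    have "numerical_radius X T \<le> dual_norm N X * N (U ** T ** conj_transpose U)"
      using cmod_normalized_trace_le[of X "U ** T ** conj_transpose U"] U(2)
      by (simp add: matrix_mul_assoc)
    also have "\<dots> = dual_norm N X * N T"
      using assms(2) U(1) by (simp add: weakly_unitarily_invariant_def)
    also have "\<dots> \<le> N T"
      using mult_right_mono[OF X nonneg[of T]] by simp
    finally show ?thesis .
  qed
  obtain X where X: "dual_norm N X \<le> 1" "N T \<le> cmod (normalized_trace (X ** T))"
    by (rule dual_norm_attained)
  have "cmod (normalized_trace (X ** T)) \<le> numerical_radius X T"
    using numerical_radius_attained[of X T] mat_1_unitary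
    by (metis conj_transpose_mat_1 matrix_mul_rid)
  with X have "N T \<le> numerical_radius X T"
    by simp
  also have "\<dots> \<le> (SUP X\<in>{X. dual_norm N X \<le> 1}. numerical_radius X T)"
    using le X(1) by (intro cSUP_upper bdd_aboveI2[where M = "N T"]) auto
  finally have "N T \<le> (SUP X\<in>{X. dual_norm N X \<le> 1}. numerical_radius X T)" .
  moreover have "(SUP X\<in>{X. dual_norm N X \<le> 1}. numerical_radius X T) \<le> N T"
    using le X(1) by (intro cSUP_least) auto
  ultimately show ?thesis
    by (rule antisym)
qed

end
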